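(* Let $2\le p<\infty$, let $q$ be defined by $\frac1p+\frac1q=1$, let $\epsilon>0$, let $x_0\in\mathbb{R}^d$, let $B_p(\epsilon)=\{\delta\in\mathbb{R}^d:\|\delta\|_p\le\epsilon\}$, and let $\ell$ be a real-valued function that is twice continuously differentiable on an open neighbourhood of $x_0+B_p(\epsilon)$, with Hessian $\nabla_x^2\ell(x_0+\delta)$ positive definite for all $\delta\in B_p(\epsilon)$. Assume $\nabla_x\ell(x_0)\neq0$. Then an optimal perturbation $\delta^\star$, i.e. a maximizer of $\delta\mapsto\ell(x_0+\delta)$ over $B_p(\epsilon)$, exists and solves the fixed-point equation $\delta^\star=F_p(\delta^\star)$, where $$F_p(\delta)=\epsilon\,\operatorname{sign}\bigl(\nabla_x\ell(x_0+\delta)\bigr)\left|\frac{\nabla_x\ell(x_0+\delta)}{\|\nabla_x\ell(x_0+\delta)\|_q}\right|^{q-1},$$ with $\operatorname{sign}$, absolute value, power and multiplication all taken element-wise.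
   Context: $\nabla_x\ell$ and $\nabla_x^2\ell$ denote the gradient and Hessian of the loss $\ell$ with respect to its input in $\mathbb{R}^d$. $\|v\|_r=(\sum_i|v_i|^r)^{1/r}$. The sign function satisfies $\operatorname{sign}(0)=0$. $F_p(\delta)$ is defined for those $\delta\in B_p(\epsilon)$ with $\nabla_x\ell(x_0+\delta)\ne0$. *)

theory Defs
  imports "HOL-Analysis.Analysis"
begin

definition lp_norm :: "real \<Rightarrow> real ^ 'n \<Rightarrow> real" where
  "lp_norm r v = (\<Sum>i\<in>UNIV. \<bar>v $ i\<bar> powr r) powr (1 / r)"

definition lp_ball :: "real \<Rightarrow> real \<Rightarrow> (real ^ 'n) set" where
  "lp_ball p \<epsilon> = {\<delta>. lp_norm p \<delta> \<le> \<epsilon>}"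

(* Meaningful only where f is differentiable. *)
definition grad :: "(real ^ 'n \<Rightarrow> real) \<Rightarrow> real ^ 'n \<Rightarrow> real ^ 'n" where
  "grad f x = (THE D. GDERIV f x :> D)"

definition hessian :: "(real ^ 'n \<Rightarrow> real) \<Rightarrow> real ^ 'n \<Rightarrow> real ^ 'n ^ 'n" where
  "hessian f x = jacobian (grad f) (at x)"

(* Intended for open U: grad f must have a derivative at each point of U. *)
definition twice_cont_diff_on :: "(real ^ 'n \<Rightarrow> real) \<Rightarrow> (real ^ 'n) set \<Rightarrow> bool" where
  "twice_cont_diff_on f U \<longleftrightarrow>
     (\<forall>x\<in>U. f differentiable (at x)) \<and>
     (\<forall>x\<in>U. grad f differentiable (at x)) \<and>
     continuous_on U (hessian f)"

(* Symmetry is not included: it is automatic for the Hessian of a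
   twice continuously differentiable function. *)
definition pos_definite :: "real ^ 'n ^ 'n \<Rightarrow> bool" where
  "pos_definite A \<longleftrightarrow> (\<forall>v. v \<noteq> 0 \<longrightarrow> v \<bullet> (A *v v) > 0)"

definition optimal_perturbation ::
    "(real ^ 'n \<Rightarrow> real) \<Rightarrow> real ^ 'n \<Rightarrow> real \<Rightarrow> real \<Rightarrow> real ^ 'n \<Rightarrow> bool" where
  "optimal_perturbation l x0 p \<epsilon> \<delta> \<longleftrightarrow>
     is_arg_max (\<lambda>\<delta>. l (x0 + \<delta>)) (\<lambda>\<delta>. \<delta> \<in> lp_ball p \<epsilon>) \<delta>"

(* The map F_p, parametrised by the exponent q conjugate to p.
   It is meaningful only where the gradient at x0 + \<delta> is nonzero; the junk value
   elsewhere must be excluded separately. *)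
definition fixed_point_map ::
    "(real ^ 'n \<Rightarrow> real) \<Rightarrow> real ^ 'n \<Rightarrow> real \<Rightarrow> real \<Rightarrow> real ^ 'n \<Rightarrow> real ^ 'n" where
  "fixed_point_map l x0 q \<epsilon> \<delta> =
     (let g = grad l (x0 + \<delta>)
      in \<chi> i. \<epsilon> * sgn (g $ i) * \<bar>g $ i / lp_norm q g\<bar> powr (q - 1))"

end

theory Submission
  imports Defs
begin

text \<open>
  Restricted to a segment of the ball, \<open>l\<close> has positive second derivative, so \<open>l\<close> lies strictly
  above its tangent planes. Hence the gradient \<open>g\<close> at a maximizer \<open>\<delta>\<close> cannot vanish (compare with the
  centre of the ball), and \<open>\<delta>\<close> also maximizes the linear functional \<open>y \<mapsto> g \<bullet> y\<close> over the ball.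
  The equality case of Young's inequality identifies the only maximizer of this functional.
\<close>

section \<open>Gradients, Hessians and the strict tangent-plane inequality\<close>

lemma has_derivative_grad:
  fixes f :: "real ^ 'n \<Rightarrow> real"
  assumes "f differentiable (at x)"
  shows "(f has_derivative (\<lambda>h. grad f x \<bullet> h)) (at x)"
proof -
  obtain f' where f': "(f has_derivative f') (at x)"
    using assms by (auto simp: differentiable_def)
  interpret linear f'
    using f' by (rule has_derivative_linear)
  \<comment> \<open>The coordinates of the representing vector are the values of the derivative on
    the standard basis.\<close>
  define D where "D = (\<chi> i. f' (axis i 1))"
  have "f' h = h \<bullet> D" for h
  proof -
    have "f' h = f' (\<Sum>i\<in>UNIV. h $ i *s axis i 1)"
      by (simp add: basis_expansion)
    also have "\<dots> = h \<bullet> D"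
      by (simp add: sum scale D_def inner_vec_def scalar_mult_eq_scaleR)
    finally show ?thesis .
  qed
  then have "f' = (\<lambda>h. h \<bullet> D)"
    by (rule ext)
  then have "GDERIV f x :> D"
    using f' by (simp add: gderiv_def)
  \<comment> \<open>Uniqueness of this vector makes the \<open>THE\<close> in \<open>grad\<close>
    denote it.\<close>
  moreover have "E = D" if "GDERIV f x :> E" for E
  proof -
    have "(\<lambda>h. h \<bullet> E) = (\<lambda>h. h \<bullet> D)"
      using that \<open>GDERIV f x :> D\<close> unfolding gderiv_def by (rule has_derivative_unique)
    then show ?thesis
      by (metis vector_eq_rdot inner_commute)
  qed
  ultimately have "GDERIV f x :> grad f x"
    unfolding grad_def by (rule theI)
  then show ?thesis
    by (simp add: gderiv_def inner_commute)
qed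

lemma grad_has_derivative_hessian:
  assumes "grad f differentiable (at x)"
  shows "(grad f has_derivative (\<lambda>h. hessian f x *v h)) (at x)"
  using assms unfolding hessian_def by (simp flip: jacobian_works)

text \<open>Along the segment, the second derivative is the Hessian's quadratic form at
  \<open>v\<close>, which is positive. Two applications of the mean value theorem turn this into the
  inequality: one writes the increment of \<open>f\<close> as the slope at some \<open>c\<close>,
  the other shows that this slope exceeds the slope at 0.\<close>

lemma less_of_pos_definite_hessian:
  fixes f :: "real ^ 'n \<Rightarrow> real"
  assumes f: "\<And>t. 0 \<le> t \<Longrightarrow> t \<le> 1 \<Longrightarrow> f differentiable (at (x + t *\<^sub>R v))"
    and f': "\<And>t. 0 \<le> t \<Longrightarrow> t \<le> 1 \<Longrightarrow> grad f differentiable (at (x + t *\<^sub>R v))"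
    and pos: "\<And>t. 0 \<le> t \<Longrightarrow> t \<le> 1 \<Longrightarrow> pos_definite (hessian f (x + t *\<^sub>R v))"
    and "v \<noteq> 0"
  shows "f x + grad f x \<bullet> v < f (x + v)"
proof -
  define \<phi>' where "\<phi>' t = grad f (x + t *\<^sub>R v) \<bullet> v" for t
  define \<phi>'' where "\<phi>'' t = (hessian f (x + t *\<^sub>R v) *v v) \<bullet> v" for t
  have D1: "((\<lambda>t. f (x + t *\<^sub>R v)) has_real_derivative \<phi>' t) (at t)" if "0 \<le> t" "t \<le> 1" for t
  proof -
    have "((\<lambda>t. f (x + t *\<^sub>R v)) has_derivative (\<lambda>s. grad f (x + t *\<^sub>R v) \<bullet> (s *\<^sub>R v))) (at t)"
      by (rule has_derivative_compose[where g = f and f = "\<lambda>t. x + t *\<^sub>R v",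
            OF _ has_derivative_grad[OF f[OF that]]])
        (auto intro!: derivative_eq_intros)
    then show ?thesis
      by (simp add: has_field_derivative_def \<phi>'_def mult_commute_abs)
  qed
  have D2: "(\<phi>' has_real_derivative \<phi>'' t) (at t)" if "0 \<le> t" "t \<le> 1" for t
  proof -
    have "((\<lambda>t. grad f (x + t *\<^sub>R v)) has_derivative
        (\<lambda>s. hessian f (x + t *\<^sub>R v) *v (s *\<^sub>R v))) (at t)"
      by (rule has_derivative_compose[where g = "grad f" and f = "\<lambda>t. x + t *\<^sub>R v",
            OF _ grad_has_derivative_hessian[OF f'[OF that]]])
        (auto intro!: derivative_eq_intros)
    then have "((\<lambda>t. grad f (x + t *\<^sub>R v) \<bullet> v) has_derivative
        (\<lambda>s. (hessian f (x + t *\<^sub>R v) *v (s *\<^sub>R v)) \<bullet> v)) (at t)"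
      by (rule has_derivative_inner_left)
    then show ?thesis
      by (simp add: has_field_derivative_def \<phi>'_def[abs_def] \<phi>''_def matrix_vector_mult_scaleR
          mult_commute_abs)
  qed
  obtain c where c: "0 < c" "c < 1" "f (x + 1 *\<^sub>R v) - f (x + 0 *\<^sub>R v) = (1 - 0) * \<phi>' c"
    using MVT2[of 0 1 "\<lambda>t. f (x + t *\<^sub>R v)" \<phi>'] D1 by auto
  obtain d where d: "0 < d" "d < c" "\<phi>' c - \<phi>' 0 = (c - 0) * \<phi>'' d"
    using MVT2[of 0 c \<phi>' \<phi>''] D2 c by auto
  have "\<phi>'' d > 0"
    using pos[of d] c d \<open>v \<noteq> 0\<close> by (simp add: \<phi>''_def pos_definite_def inner_commute)
  then have "\<phi>' 0 < \<phi>' c"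
    using c d by (simp add: algebra_simps)
  then show ?thesis
    using c by (simp add: \<phi>'_def)
qed

section \<open>Convexity and compactness of the ball\<close>

lemma mem_lp_ball_iff:
  assumes "p > 0" "\<epsilon> \<ge> 0"
  shows "\<delta> \<in> lp_ball p \<epsilon> \<longleftrightarrow> (\<Sum>i\<in>UNIV. \<bar>\<delta> $ i\<bar> powr p) \<le> \<epsilon> powr p"
proof -
  let ?S = "\<Sum>i\<in>UNIV. \<bar>\<delta> $ i\<bar> powr p"
  have S: "?S \<ge> 0"
    by (simp add: sum_nonneg)
  \<comment> \<open>The p-th power is strictly increasing on the nonnegative reals, so applying it
    to both sides gives an equivalence and cancels the root in \<open>lp_norm\<close>.\<close>
  have "?S powr (1 / p) \<le> \<epsilon> \<longleftrightarrow> (?S powr (1 / p)) powr p \<le> \<epsilon> powr p"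
    using assms powr_mono2[of p "?S powr (1 / p)" \<epsilon>] powr_less_mono2[of p \<epsilon> "?S powr (1 / p)"]
    by (auto simp: not_le[symmetric])
  then show ?thesis
    using assms S by (simp add: lp_ball_def lp_norm_def powr_powr)
qed

lemma convex_on_powr_nonneg:
  assumes "1 \<le> (p::real)"
  shows "convex_on {0..} (\<lambda>x. x powr p)"
proof (rule convex_on_linorderI)
  fix t x y :: real
  assume t: "0 < t" "t < 1" and xy: "x \<in> {0..}" "y \<in> {0..}" "x < y"
  show "((1 - t) *\<^sub>R x + t *\<^sub>R y) powr p \<le> (1 - t) * x powr p + t * y powr p"
  \<comment> \<open>Only the smaller point can be 0. There the claim reduces to
    \<open>t powr p\<close> \<le> \<open>t\<close> for 0 < t < 1.\<close>
  proof (cases "x = 0")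
    case True
    have "t powr p \<le> t powr 1"
      using t assms by (intro powr_mono') auto
    then show ?thesis
      using True t xy by (simp add: powr_mult mult_right_mono)
  next
    case False
    then show ?thesis
      using convex_onD[OF powr_convex[OF assms], of t x y] t xy by simp
  qed
qed simp

text \<open>The ball is a sublevel set of a sum of p-th powers, each convex in its coordinate, so
  Minkowski's inequality is avoided.\<close>

lemma convex_lp_ball:
  assumes "1 \<le> p" "\<epsilon> \<ge> 0"
  shows "convex (lp_ball p \<epsilon> :: (real ^ 'n) set)"
proof (rule convexI)
  fix x y :: "real ^ 'n" and u v :: real
  assume x: "x \<in> lp_ball p \<epsilon>" and y: "y \<in> lp_ball p \<epsilon>" and uv: "0 \<le> u" "0 \<le> v" "u + v = 1"
  have "\<bar>u * x $ i + v * y $ i\<bar> powr p \<le> u * \<bar>x $ i\<bar> powr p + v * \<bar>y $ i\<bar> powr p" for i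
  proof -
    have "\<bar>u * x $ i + v * y $ i\<bar> powr p \<le> (u * \<bar>x $ i\<bar> + v * \<bar>y $ i\<bar>) powr p"
      using uv assms by (intro powr_mono2) (auto intro: order_trans[OF abs_triangle_ineq] simp: abs_mult)
    also have "\<dots> \<le> u * \<bar>x $ i\<bar> powr p + v * \<bar>y $ i\<bar> powr p"
      using convex_onD[OF convex_on_powr_nonneg[OF assms(1)], of v "\<bar>x $ i\<bar>" "\<bar>y $ i\<bar>"] uv
      by (simp add: eq_diff_eq[symmetric])
    finally show ?thesis .
  qed
  then have "(\<Sum>i\<in>UNIV. \<bar>(u *\<^sub>R x + v *\<^sub>R y) $ i\<bar> powr p)
      \<le> u * (\<Sum>i\<in>UNIV. \<bar>x $ i\<bar> powr p) + v * (\<Sum>i\<in>UNIV. \<bar>y $ i\<bar> powr p)"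
    by (simp add: sum_distrib_left sum_mono flip: sum.distrib)
  also have "\<dots> \<le> \<epsilon> powr p"
    using x y uv assms by (intro convex_bound_le) (auto simp: mem_lp_ball_iff)
  finally show "u *\<^sub>R x + v *\<^sub>R y \<in> lp_ball p \<epsilon>"
    using assms by (simp add: mem_lp_ball_iff)
qed

lemma compact_lp_ball:
  assumes "p > 0" "\<epsilon> \<ge> 0"
  shows "compact (lp_ball p \<epsilon> :: (real ^ 'n) set)"
proof -
  have "\<bar>\<delta> $ i\<bar> \<le> \<epsilon>" if "\<delta> \<in> lp_ball p \<epsilon>" for \<delta> :: "real ^ 'n" and i
  proof -
    have "\<bar>\<delta> $ i\<bar> powr p \<le> (\<Sum>j\<in>UNIV. \<bar>\<delta> $ j\<bar> powr p)"
      by (rule member_le_sum) auto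
    also have "\<dots> \<le> \<epsilon> powr p"
      using that assms by (simp add: mem_lp_ball_iff)
    finally show ?thesis
      using powr_less_mono2[of p \<epsilon> "\<bar>\<delta> $ i\<bar>"] assms by force
  qed
  then have "bounded (lp_ball p \<epsilon> :: (real ^ 'n) set)"
    \<comment> \<open>Each coordinate is at most \<epsilon> in absolute value, and the Euclidean
      norm is at most the sum of these absolute values.\<close>
    by (intro boundedI[where B = "of_nat CARD('n) * \<epsilon>"] order_trans[OF norm_le_l1_cart] sum_bounded_above)
  moreover have "closed (lp_ball p \<epsilon> :: (real ^ 'n) set)"
  proof -
    have "lp_ball p \<epsilon> = {\<delta> :: real ^ 'n. (\<Sum>i\<in>UNIV. \<bar>\<delta> $ i\<bar> powr p) \<le> \<epsilon> powr p}"
      using assms by (auto simp: mem_lp_ball_iff)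
    also have "closed \<dots>"
      using assms
      by (intro closed_Collect_le continuous_on_sum continuous_on_powr' continuous_intros) auto
    finally show ?thesis .
  qed
  ultimately show ?thesis
    by (simp add: compact_eq_bounded_closed)
qed

section \<open>Young's inequality and its equality case\<close>

lemma conjugate_exponent_gt_1:
  fixes p q :: real
  assumes "p > 1" "1 / p + 1 / q = 1"
  shows "q > 1"
proof -
  have "1 / p > 0" "1 / p < 1"
    using assms(1) by auto
  then have "1 / q > 0" "1 / q < 1"
    using assms(2) by linarith+
  then show ?thesis
    by (simp add: field_simps)
qed

text \<open>Let \<open>s\<close> and \<open>t\<close> be the ratios of \<open>a powr q\<close> and
  \<open>b powr p\<close> to \<open>a * b\<close>. Their logarithms, weighted by 1/q and 1/p, sum to
  0, so the gap in the inequality is \<open>a * b\<close> times a positive combination of s - 1 - ln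
  s and t - 1 - ln t. Both terms are nonnegative, and equality forces s = 1.\<close>

lemma Youngs_inequality_with_equality:
  fixes a b p q :: real
  assumes "p > 1" "1 / p + 1 / q = 1" "a \<ge> 0" "b \<ge> 0"
  shows "a * b \<le> a powr q / q + b powr p / p"
    and "a * b = a powr q / q + b powr p / p \<Longrightarrow> b = a powr (q - 1)"
proof -
  have q: "q > 1"
    using conjugate_exponent_gt_1[OF assms(1,2)] .
  have "a * b \<le> a powr q / q + b powr p / p \<and>
    (a * b = a powr q / q + b powr p / p \<longrightarrow> b = a powr (q - 1))"
  proof (cases "a = 0 \<or> b = 0")
    \<comment> \<open>Equality forces both factors to be 0, which agrees with
      \<open>0 powr (q - 1) = 0\<close>.\<close>
    case True
    then show ?thesis
      using assms q by auto
  next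
    case False
    then have ab: "a > 0" "b > 0"
      using assms by auto
    define s where "s = a powr (q - 1) / b"
    define t where "t = b powr (p - 1) / a"
    have st: "s > 0" "t > 0"
      using ab by (auto simp: s_def t_def)
    have pq: "(p - 1) * (q - 1) = 1"
      using assms q by (simp add: field_simps)
    have "ln s / q + ln t / p = ((q - 1) / q - 1 / p) * ln a + ((p - 1) / p - 1 / q) * ln b"
      using ab by (simp add: s_def t_def ln_div ln_powr algebra_simps diff_divide_distrib add_divide_distrib)
    also have "\<dots> = 0"
      using assms q by (simp add: diff_divide_distrib algebra_simps)
    finally have ln0: "ln s / q + ln t / p = 0" .
    have split: "a powr q / q + b powr p / p - a * b = a * b * ((s - 1 - ln s) / q + (t - 1 - ln t) / p)"
    proof -
      have "a * b * s = a powr q" "a * b * t = b powr p"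
        using ab by (auto simp: s_def t_def powr_diff)
      moreover have "(s - 1 - ln s) / q + (t - 1 - ln t) / p = s / q + t / p - 1"
        using assms(2) ln0 by (simp add: diff_divide_distrib)
      moreover have "a * b * (s / q + t / p - 1) = (a * b * s) / q + (a * b * t) / p - a * b"
        by (simp add: algebra_simps)
      ultimately show ?thesis
        by simp
    qed
    have ge: "(s - 1 - ln s) / q \<ge> 0" "(t - 1 - ln t) / p \<ge> 0"
      using st assms(1) q ln_le_minus_one[of s] ln_le_minus_one[of t] by auto
    then have "a * b \<le> a powr q / q + b powr p / p"
      using split ab by (smt (verit) mult_nonneg_nonneg)
    moreover have "b = a powr (q - 1)" if "a * b = a powr q / q + b powr p / p"
    proof -
      have "(s - 1 - ln s) / q + (t - 1 - ln t) / p = 0"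
        using that split ab by auto
      then have "ln s = s - 1"
        using ge q by (simp add: add_nonneg_eq_0_iff)
      then have "s = 1"
        using st ln_eq_minus_one by blast
      then show ?thesis
        using ab by (simp add: s_def)
    qed
    ultimately show ?thesis by blast
  qed
  then show "a * b \<le> a powr q / q + b powr p / p"
    and "a * b = a powr q / q + b powr p / p \<Longrightarrow> b = a powr (q - 1)"
    by auto
qed

section \<open>Maximizing a linear functional over the ball\<close>

lemma lp_norm_pos:
  assumes "g \<noteq> 0"
  shows "lp_norm q g > 0"
proof -
  obtain j where "g $ j \<noteq> 0"
    using assms by (auto simp: vec_eq_iff)
  then have "0 < (\<Sum>i\<in>UNIV. \<bar>g $ i\<bar> powr q)"
    by (intro sum_pos2[of _ j]) auto
  then show ?thesis
    by (simp add: lp_norm_def)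
qed

lemma lp_norm_powr:
  assumes "r \<noteq> 0"
  shows "lp_norm r g powr r = (\<Sum>i\<in>UNIV. \<bar>g $ i\<bar> powr r)"
  using assms by (simp add: lp_norm_def powr_powr sum_nonneg)

text \<open>For nonzero \<open>g\<close> and \<open>q\<close> conjugate to \<open>p\<close>, this is
  the point of the ball where Hoelder's inequality against \<open>g\<close> is an equality.
  \<open>fixed_point_map\<close> is the case where \<open>g\<close> is the gradient at
  \<open>x0 + \<delta>\<close>.\<close>

definition dual_point :: "real \<Rightarrow> real \<Rightarrow> real ^ 'n \<Rightarrow> real ^ 'n" where
  "dual_point q \<epsilon> g = (\<chi> i. \<epsilon> * sgn (g $ i) * \<bar>g $ i / lp_norm q g\<bar> powr (q - 1))"

context
  fixes p q \<epsilon> :: real and g :: "real ^ 'n"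
  assumes p: "p > 1" and pq: "1 / p + 1 / q = 1" and \<epsilon>: "\<epsilon> > 0" and g: "g \<noteq> 0"
begin

lemma q_gt_1: "q > 1"
  using conjugate_exponent_gt_1[OF p pq] .

lemma sum_normalized: "(\<Sum>i\<in>UNIV. \<bar>g $ i / lp_norm q g\<bar> powr q) = 1"
proof -
  have "(\<Sum>i\<in>UNIV. \<bar>g $ i / lp_norm q g\<bar> powr q)
      = (\<Sum>i\<in>UNIV. \<bar>g $ i\<bar> powr q) / lp_norm q g powr q"
    using lp_norm_pos[OF g, of q] by (simp add: powr_divide sum_divide_distrib)
  then show ?thesis
    using lp_norm_pos[OF g, of q] q_gt_1 by (simp flip: lp_norm_powr)
qed

text \<open>Since (q - 1) p = q, the p-th powers of the coordinates are \<epsilon>^p times the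
  normalized q-th powers, which sum to 1.\<close>

lemma dual_point_in_lp_ball: "dual_point q \<epsilon> g \<in> lp_ball p \<epsilon>"
proof -
  have "(q - 1) * p = q"
    using p pq q_gt_1 by (simp add: field_simps)
  then have "\<bar>dual_point q \<epsilon> g $ i\<bar> powr p = \<epsilon> powr p * \<bar>g $ i / lp_norm q g\<bar> powr q" for i
    using \<epsilon> p by (cases "g $ i = 0") (auto simp: dual_point_def abs_mult powr_mult powr_powr abs_sgn_eq)
  then show ?thesis
    using p \<epsilon> sum_normalized by (simp add: mem_lp_ball_iff flip: sum_distrib_left)
qed

lemma inner_dual_point: "g \<bullet> dual_point q \<epsilon> g = \<epsilon> * lp_norm q g"
proof -
  have "g $ i * dual_point q \<epsilon> g $ i = \<epsilon> * lp_norm q g * \<bar>g $ i / lp_norm q g\<bar> powr q" for i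
  proof (cases "g $ i = 0")
    case False
    then show ?thesis
      using lp_norm_pos[OF g, of q]
      by (simp add: dual_point_def powr_diff abs_mult sgn_if)
  qed simp
  then show ?thesis
    using sum_normalized by (simp add: inner_vec_def flip: sum_distrib_left)
qed

text \<open>After normalization, \<open>z i\<close> \<le> \<open>u i * w i\<close> \<le>
  \<open>y i\<close> in each coordinate, while the \<open>y i\<close> sum to at most 1 and the
  \<open>z i\<close> to at least 1. So all these inequalities are equalities: the second fixes the
  moduli through Young, the first fixes the signs.\<close>

lemma eq_dual_point:
  assumes "\<delta> \<in> lp_ball p \<epsilon>" and max: "g \<bullet> \<delta> \<ge> \<epsilon> * lp_norm q g"
  shows "\<delta> = dual_point q \<epsilon> g"
proof -
  define G where "G = lp_norm q g"
  define u where "u i = \<bar>g $ i / G\<bar>" for i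
  define w where "w i = \<bar>\<delta> $ i\<bar> / \<epsilon>" for i
  define y where "y i = u i powr q / q + w i powr p / p" for i
  define z where "z i = g $ i * \<delta> $ i / (\<epsilon> * G)" for i
  have G: "G > 0"
    using lp_norm_pos[OF g] by (simp add: G_def)
  have uw: "u i \<ge> 0" "w i \<ge> 0" for i
    using \<epsilon> by (auto simp: u_def w_def)
  have zuw: "z i \<le> u i * w i" for i
  proof -
    have "z i \<le> \<bar>g $ i * \<delta> $ i\<bar> / (\<epsilon> * G)"
      using G \<epsilon> by (simp add: z_def divide_right_mono)
    then show ?thesis
      using G by (simp add: u_def w_def abs_mult mult.commute)
  qed
  have uwy: "u i * w i \<le> y i" for i
    using Youngs_inequality_with_equality(1)[OF p pq uw] by (simp add: y_def)
  have "(\<Sum>i\<in>UNIV. w i powr p) = (\<Sum>i\<in>UNIV. \<bar>\<delta> $ i\<bar> powr p) / \<epsilon> powr p"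
    using \<epsilon> by (simp add: w_def powr_divide sum_divide_distrib)
  also have "\<dots> \<le> 1"
    using assms(1) p \<epsilon> by (simp add: mem_lp_ball_iff)
  finally have w1: "(\<Sum>i\<in>UNIV. w i powr p) \<le> 1" .
  have "(\<Sum>i\<in>UNIV. y i) = 1 / q + (\<Sum>i\<in>UNIV. w i powr p) / p"
    using sum_normalized by (simp add: y_def u_def G_def sum.distrib flip: sum_divide_distrib)
  also have "\<dots> \<le> 1 / q + 1 / p"
    using w1 p by (simp add: divide_right_mono)
  finally have "(\<Sum>i\<in>UNIV. y i) \<le> 1"
    using pq by simp
  moreover have "1 \<le> (\<Sum>i\<in>UNIV. z i)"
    using max G \<epsilon> by (simp add: z_def G_def inner_vec_def field_simps flip: sum_divide_distrib)
  ultimately have "(\<Sum>i\<in>UNIV. y i - z i) \<le> 0"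
    by (simp add: sum_subtractf)
  moreover have yz: "y i - z i \<ge> 0" for i
    using zuw[of i] uwy[of i] by simp
  ultimately have "(\<Sum>i\<in>UNIV. y i - z i) = 0"
    by (meson sum_nonneg order_antisym)
  then have "y i = z i" for i
    using yz by (simp add: sum_nonneg_eq_0_iff)
  then have eq: "u i * w i = y i" "z i = u i * w i" for i
    using zuw[of i] uwy[of i] by (smt (verit))+
  have w: "w i = u i powr (q - 1)" for i
    using Youngs_inequality_with_equality(2)[OF p pq uw] eq(1) by (simp add: y_def)
  have "\<delta> $ i = dual_point q \<epsilon> g $ i" for i
  proof (cases "g $ i = 0")
    \<comment> \<open>No sign information is available here, but
      \<open>w i = 0 powr (q - 1) = 0\<close> already forces the coordinate of \<delta> to
      vanish.\<close>
    case True
    then show ?thesis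
      using w[of i] \<epsilon> by (simp add: dual_point_def u_def w_def)
  next
    case False
    have "g $ i * \<delta> $ i = \<bar>g $ i\<bar> * \<bar>\<delta> $ i\<bar>"
      using eq(2)[of i] G \<epsilon> by (simp add: z_def u_def w_def field_simps)
    then have "\<delta> $ i = sgn (g $ i) * \<bar>\<delta> $ i\<bar>"
      using False by (auto simp: sgn_if abs_if split: if_splits)
    also have "\<bar>\<delta> $ i\<bar> = \<epsilon> * w i"
      using \<epsilon> by (simp add: w_def)
    finally show ?thesis
      using w[of i] by (simp add: dual_point_def u_def G_def)
  qed
  then show ?thesis
    by (simp add: vec_eq_iff)
qed

end

section \<open>Existence of maximizers and the fixed-point equation\<close>

theorem proposition2:
  fixes p q \<epsilon> :: real
    and x0 :: "real ^ 'n"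
    and l :: "real ^ 'n \<Rightarrow> real"
    and U :: "(real ^ 'n) set"
  assumes "2 \<le> p"
    and "1 / p + 1 / q = 1"
    and "\<epsilon> > 0"
    and "open U"
    and "(\<lambda>\<delta>. x0 + \<delta>) ` lp_ball p \<epsilon> \<subseteq> U"
    and "twice_cont_diff_on l U"
    and "\<forall>\<delta>\<in>lp_ball p \<epsilon>. pos_definite (hessian l (x0 + \<delta>))"
    and "grad l x0 \<noteq> 0"
  shows "(\<exists>\<delta>. optimal_perturbation l x0 p \<epsilon> \<delta>) \<and>
         (\<forall>\<delta>. optimal_perturbation l x0 p \<epsilon> \<delta> \<longrightarrow>
              grad l (x0 + \<delta>) \<noteq> 0 \<and> \<delta> = fixed_point_map l x0 q \<epsilon> \<delta>)"
proof (intro conjI allI impI)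
  let ?B = "lp_ball p \<epsilon> :: (real ^ 'n) set"
  have p: "p > 1"
    using assms(1) by simp
  have zero: "0 \<in> ?B"
    using p assms(3) by (simp add: mem_lp_ball_iff)
  have diff: "l differentiable (at (x0 + \<delta>))" "grad l differentiable (at (x0 + \<delta>))"
    if "\<delta> \<in> ?B" for \<delta>
    using assms(5,6) that by (auto simp: twice_cont_diff_on_def)
  have tangent: "l (x0 + \<delta>) + grad l (x0 + \<delta>) \<bullet> (y - \<delta>) < l (x0 + y)"
    if "\<delta> \<in> ?B" "y \<in> ?B" "y \<noteq> \<delta>" for \<delta> y
  proof -
    \<comment> \<open>Convexity keeps the segment inside the ball, where the Hessian is positive
      definite.\<close>
    have mem: "\<delta> + t *\<^sub>R (y - \<delta>) \<in> ?B" if "0 \<le> t" "t \<le> 1" for t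
      using convexD_alt[OF convex_lp_ball \<open>\<delta> \<in> ?B\<close> \<open>y \<in> ?B\<close> that] p assms(3)
      by (simp add: algebra_simps)
    have "l (x0 + \<delta>) + grad l (x0 + \<delta>) \<bullet> (y - \<delta>) < l ((x0 + \<delta>) + (y - \<delta>))"
      using diff[OF mem] assms(7) mem that(3)
      by (intro less_of_pos_definite_hessian) (auto simp: add.assoc)
    then show ?thesis
      by simp
  qed
  show "\<exists>\<delta>. optimal_perturbation l x0 p \<epsilon> \<delta>"
  proof -
    have "continuous_on ?B (\<lambda>\<delta>. l (x0 + \<delta>))"
    proof (rule continuous_at_imp_continuous_on, rule ballI)
      fix \<delta> assume "\<delta> \<in> ?B"
      then have "isCont l (x0 + \<delta>)"
        by (intro differentiable_imp_continuous_within diff)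
      then show "isCont (\<lambda>\<delta>. l (x0 + \<delta>)) \<delta>"
        by (intro isCont_o2[of _ "\<lambda>\<delta>. x0 + \<delta>" l] continuous_intros)
    qed
    then obtain \<delta> where "\<delta> \<in> ?B" "\<forall>y\<in>?B. l (x0 + y) \<le> l (x0 + \<delta>)"
      using continuous_attains_sup[of ?B] compact_lp_ball[of p \<epsilon>] zero p assms(3) by auto
    then show ?thesis
      by (auto simp: optimal_perturbation_def is_arg_max_linorder)
  qed
  fix \<delta> assume "optimal_perturbation l x0 p \<epsilon> \<delta>"
  then have \<delta>: "\<delta> \<in> ?B" and max: "\<And>y. y \<in> ?B \<Longrightarrow> l (x0 + y) \<le> l (x0 + \<delta>)"
    by (auto simp: optimal_perturbation_def is_arg_max_linorder)
  define g where "g = grad l (x0 + \<delta>)"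
  show g: "grad l (x0 + \<delta>) \<noteq> 0"
  proof (cases "\<delta> = 0")
    \<comment> \<open>A vanishing gradient would make the tangent inequality at \<delta> say that
      the centre has a strictly larger value.\<close>
    case False
    then show ?thesis
      using tangent[OF \<delta> zero] max[OF zero] by auto
  qed (use assms(8) in simp)
  \<comment> \<open>If \<open>g\<close> had a larger or equal value at some other \<open>y\<close>,
    the tangent plane at \<delta>, and hence \<open>l\<close>, would give \<open>y\<close> a loss
    above the maximum.\<close>
  have "g \<bullet> y \<le> g \<bullet> \<delta>" if "y \<in> ?B" for y
    using tangent[OF \<delta> that] max[OF that] by (cases "y = \<delta>") (auto simp: g_def inner_diff_right)
  \<comment> \<open>The competitor is \<open>y = dual_point q \<epsilon> g\<close>.\<close>
  then have "\<epsilon> * lp_norm q g \<le> g \<bullet> \<delta>"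
    using dual_point_in_lp_ball inner_dual_point p assms(2,3) g by (metis g_def)
  then have "\<delta> = dual_point q \<epsilon> g"
    using eq_dual_point \<delta> p assms(2,3) g by (simp add: g_def)
  then show "\<delta> = fixed_point_map l x0 q \<epsilon> \<delta>"
    by (simp add: fixed_point_map_def dual_point_def g_def Let_def)
qed

end
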